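(* There exist absolute constants $H \in (0,1)$, $c_1 > 0$ and $c_2 > 0$ such that the following holds. Let $\eta \in (0,H)$, $n \ge 120$ and $0 < \epsilon \le \frac{1}{11(n-1)}$. Then every (possibly asymmetric) plurality voting scheme for $\mathcal{I}(n,\epsilon)$ using $m \le c_1 \frac{n^3}{\epsilon^2}\ln\frac{1}{\eta}$ voters fails with probability at least $c_2 \eta$; that is, there is an urn $i$ such that, if $i$ is the correct urn, the probability that urn $i$ does not receive strictly more votes than every other urn is at least $c_2\eta$.
   Context: The instance $\mathcal{I}(n,\epsilon)$ consists of $n$ bichromatic urns, urn $i$ having a fraction $p_i = \frac{1-\epsilon(n-1)}{2} + (i-1)\epsilon$ of blue balls and $1-p_i$ of red balls ($i=1,\dots,n$). One urn is the correct urn; each of $m$ voters independently draws one ball (with replacement) from it and observes its color. A (possibly asymmetric) plurality voting scheme with $m$ voters is given by, for each voter $t$, two probability vectors $(R_{1,t},\dots,R_{n,t})$ and $(B_{1,t},\dots,B_{n,t})$: if voter $t$ draws red (resp. blue), she votes for exactly one urn, choosing urn $i$ with probability $R_{i,t}$ (resp. $B_{i,t}$), independently of all other voters. The votes for each urn are counted. *)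

theory Defs
  imports "HOL-Probability.Probability" "HOL-Probability.Product_PMF"
begin

text \<open>Urns are indexed by \<^term>\<open>{1..n}\<close> and voters by \<^term>\<open>{1..m}\<close>.\<close>

definition blue_fraction :: "nat \<Rightarrow> real \<Rightarrow> nat \<Rightarrow> real" where
  "blue_fraction n \<epsilon> i = (1 - \<epsilon> * (real n - 1)) / 2 + (real i - 1) * \<epsilon>"

text \<open>The probability vector used by voter \<^term>\<open>t\<close> upon drawing red (blue) is represented by the
  probability mass function \<^term>\<open>R t\<close> (\<^term>\<open>B t\<close>) on the set of urns, so the weight given to
  urn \<^term>\<open>i\<close> is \<^term>\<open>pmf (R t) i\<close> (\<^term>\<open>pmf (B t) i\<close>).\<close>

definition plurality_scheme ::
  "nat \<Rightarrow> nat \<Rightarrow> (nat \<Rightarrow> nat pmf) \<Rightarrow> (nat \<Rightarrow> nat pmf) \<Rightarrow> bool" where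
  "plurality_scheme n m R B \<longleftrightarrow>
     (\<forall>t\<in>{1..m}. set_pmf (R t) \<subseteq> {1..n} \<and> set_pmf (B t) \<subseteq> {1..n})"

text \<open>The outcome \<^term>\<open>True\<close> of the Bernoulli draw stands for a blue ball. Note that
  \<^const>\<open>bernoulli_pmf\<close> truncates its parameter to the unit interval; this has no effect when
  \<^term>\<open>0 \<le> \<epsilon> \<and> \<epsilon> * (real n - 1) \<le> 1\<close> and \<^term>\<open>i \<in> {1..n}\<close>.\<close>

definition vote_pmf ::
  "nat \<Rightarrow> real \<Rightarrow> (nat \<Rightarrow> nat pmf) \<Rightarrow> (nat \<Rightarrow> nat pmf) \<Rightarrow> nat \<Rightarrow> nat \<Rightarrow> nat pmf" where
  "vote_pmf n \<epsilon> R B i t =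
     bind_pmf (bernoulli_pmf (blue_fraction n \<epsilon> i)) (\<lambda>blue. if blue then B t else R t)"

text \<open>The default value 0 is only taken outside the set of voters.\<close>

definition ballots_pmf ::
  "nat \<Rightarrow> real \<Rightarrow> nat \<Rightarrow> (nat \<Rightarrow> nat pmf) \<Rightarrow> (nat \<Rightarrow> nat pmf) \<Rightarrow> nat \<Rightarrow> (nat \<Rightarrow> nat) pmf" where
  "ballots_pmf n \<epsilon> m R B i = Pi_pmf {1..m} 0 (vote_pmf n \<epsilon> R B i)"

definition votes :: "nat \<Rightarrow> (nat \<Rightarrow> nat) \<Rightarrow> nat \<Rightarrow> nat" where
  "votes m v j = card {t \<in> {1..m}. v t = j}"

definition plurality_winner :: "nat \<Rightarrow> nat \<Rightarrow> (nat \<Rightarrow> nat) \<Rightarrow> nat \<Rightarrow> bool" where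
  "plurality_winner n m v i \<longleftrightarrow> (\<forall>j\<in>{1..n} - {i}. votes m v j < votes m v i)"

definition failure_prob ::
  "nat \<Rightarrow> real \<Rightarrow> nat \<Rightarrow> (nat \<Rightarrow> nat pmf) \<Rightarrow> (nat \<Rightarrow> nat pmf) \<Rightarrow> nat \<Rightarrow> real" where
  "failure_prob n \<epsilon> m R B i =
     measure_pmf.prob (ballots_pmf n \<epsilon> m R B i) {v. \<not> plurality_winner n m v i}"

end

theory Submission
  imports Defs
begin

text \<open>Write \<open>X\<^sub>j\<close> for the number of votes of urn \<open>j\<close>. Its expectation is affine in the blue
  fraction of the correct urn; let \<open>b\<^sub>j\<close> be the slope. Since blue fractions lie in
  \<open>[5/11, 6/11]\<close>, the variance of \<open>X\<^sub>j - X\<^sub>i\<close> is at least \<open>\<bar>b\<^sub>j\<bar> / 5\<close>. A second-moment argument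
  on \<open>exp(-l (X\<^sub>j - X\<^sub>i))\<close> shows that \<open>P(X\<^sub>j \<le> X\<^sub>i) \<le> exp(-L)/25\<close> forces the mean of \<open>X\<^sub>j - X\<^sub>i\<close>
  to be at least of order \<open>min(V, sqrt(L V))\<close>, where \<open>V\<close> is the variance. If urns \<open>i\<close> and \<open>i + 1\<close>
  both rarely fail, the mean of \<open>X\<^bsub>i+1\<^esub> - X\<^sub>i\<close> changes sign between the two blue fractions, which
  differ by \<open>\<epsilon>\<close>, so \<open>\<epsilon> (b\<^bsub>i+1\<^esub> - b\<^sub>i)\<close> exceeds these bounds. As \<open>\<epsilon>\<close> is small, the first
  alternative of the minimum is impossible, and \<open>sqrt \<bar>b\<^sub>i\<bar>\<close> grows by order \<open>sqrt L / \<epsilon>\<close> per step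
  away from the sign change. Summing, \<open>2 m \<ge> \<Sum> \<bar>b\<^sub>i\<bar>\<close> is at least of order \<open>n\<^sup>3 L / \<epsilon>\<^sup>2\<close>.\<close>

section \<open>Quadratic bounds on the exponential function\<close>

lemma exp_quadratic_lower_bound:
  fixes x :: real
  assumes "-2 \<le> x"
  shows "1 + x + x\<^sup>2 / 4 \<le> exp x"
  \<comment> \<open>This is \<open>(1 + x / 2)\<^sup>2 \<le> exp x\<close> expanded; the assumption
    keeps the base nonnegative.\<close>
  using exp_ge_one_plus_x_over_n_power_n[of 2 x] assms
  by (simp add: power2_eq_square field_simps)

lemma exp_bound_abs_le_1:
  fixes x :: real
  assumes "\<bar>x\<bar> \<le> 1"
  shows "exp x \<le> 1 + x + x\<^sup>2"
proof (cases "0 \<le> x")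
  case True
  then show ?thesis using exp_bound assms by auto
next
  case False
  define s where "s = - x"
  have s: "0 < s" "s \<le> 1" using False assms by (auto simp: s_def)
  \<comment> \<open>For negative arguments the claim follows from
    \<open>1 / (1 + s) \<le> 1 - s + s\<^sup>2\<close> and \<open>1 + s \<le> exp s\<close>.\<close>
  have "(1 - s + s\<^sup>2) * (1 + s) = 1 + s ^ 3"
    by (simp add: algebra_simps power2_eq_square power3_eq_cube)
  moreover have "0 \<le> 1 - s + s\<^sup>2" using s by simp
  ultimately have "1 \<le> (1 - s + s\<^sup>2) * exp s"
    using mult_left_mono[OF exp_ge_add_one_self[of s], of "1 - s + s\<^sup>2"] s
      zero_le_power[of s 3] by linarith
  then show ?thesis by (simp add: s_def exp_minus field_simps)
qed

text \<open>Squaring the previous bound at \<open>x / 2\<close> doubles its range at the cost of the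
  factor 3 / 2. The range 2 fits \<open>2 * l\<close> times a centred variable when
  \<open>\<bar>Y x\<bar> \<le> 1\<close> and \<open>l \<le> 1 / 2\<close>.\<close>

lemma exp_bound_abs_le_2:
  fixes x :: real
  assumes "\<bar>x\<bar> \<le> 2"
  shows "exp x \<le> 1 + x + 3 / 2 * x\<^sup>2"
proof -
  define u where "u = x / 2"
  have u: "\<bar>u\<bar> \<le> 1" "x = 2 * u" using assms by (auto simp: u_def)
  have "exp x = (exp u)\<^sup>2" by (simp add: u(2) exp_double)
  also have "\<dots> \<le> (1 + u + u\<^sup>2)\<^sup>2"
    using exp_bound_abs_le_1[OF u(1)] by (intro power_mono) auto
  also have "\<dots> = 1 + 2 * u + u\<^sup>2 * (3 + 2 * u + u\<^sup>2)"
    by (simp add: algebra_simps power2_eq_square)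
  also have "\<dots> \<le> 1 + 2 * u + u\<^sup>2 * 6"
  proof -
    have "u\<^sup>2 \<le> 1" using u(1) by (simp add: abs_square_le_1)
    then show ?thesis using u(1) by (intro add_left_mono mult_left_mono) auto
  qed
  finally show ?thesis by (simp add: u(2) power2_eq_square)
qed

section \<open>Moment generating functions of variables bounded by 1\<close>

lemma integrable_pmf_bounded:
  fixes f :: "'a \<Rightarrow> real"
  assumes "\<And>x. \<bar>f x\<bar> \<le> c"
  shows "integrable (measure_pmf q) f"
  using assms by (intro measure_pmf.integrable_const_bound[where B = c]) auto

context
  fixes q :: "'a pmf" and Y :: "'a \<Rightarrow> real"
  assumes Y: "\<And>x. \<bar>Y x\<bar> \<le> 1"
begin

lemma abs_expectation_le_1: "\<bar>measure_pmf.expectation q Y\<bar> \<le> 1"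
proof -
  have i: "integrable (measure_pmf q) Y" by (rule integrable_pmf_bounded[OF Y])
  have "-1 \<le> Y x" "Y x \<le> 1" for x using Y[of x] by auto
  then have "measure_pmf.expectation q Y \<le> 1" "-1 \<le> measure_pmf.expectation q Y"
    using i by (auto intro!: measure_pmf.integral_le_const measure_pmf.integral_ge_const)
  then show ?thesis by simp
qed

lemma abs_centered_le_2: "\<bar>Y x - measure_pmf.expectation q Y\<bar> \<le> 2"
  using Y[of x] abs_expectation_le_1 by linarith

lemma integrable_centered:
  "integrable (measure_pmf q) (\<lambda>x. Y x - measure_pmf.expectation q Y)"
  "integrable (measure_pmf q) (\<lambda>x. (Y x - measure_pmf.expectation q Y)\<^sup>2)"
proof -
  show "integrable (measure_pmf q) (\<lambda>x. Y x - measure_pmf.expectation q Y)"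
    by (rule integrable_pmf_bounded[OF abs_centered_le_2])
  have "\<bar>(Y x - measure_pmf.expectation q Y)\<^sup>2\<bar> \<le> 4" for x
    using power_mono[OF abs_centered_le_2, of x 2] by simp
  then show "integrable (measure_pmf q) (\<lambda>x. (Y x - measure_pmf.expectation q Y)\<^sup>2)"
    by (rule integrable_pmf_bounded)
qed

lemma integrable_exp_scaled: "integrable (measure_pmf q) (\<lambda>x. exp (c * Y x))"
proof (rule integrable_pmf_bounded)
  fix x
  have "c * Y x \<le> \<bar>c\<bar>"
    using Y[of x] mult_left_mono[of "\<bar>Y x\<bar>" 1 "\<bar>c\<bar>"] abs_ge_self[of "c * Y x"]
    by (simp add: abs_mult)
  then show "\<bar>exp (c * Y x)\<bar> \<le> exp \<bar>c\<bar>" by simp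
qed

lemma expectation_quadratic:
  "measure_pmf.expectation q (\<lambda>x. 1 + c * (Y x - measure_pmf.expectation q Y)
     + d * (Y x - measure_pmf.expectation q Y)\<^sup>2) = 1 + d * measure_pmf.variance q Y"
proof -
  have "measure_pmf.expectation q (\<lambda>x. Y x - measure_pmf.expectation q Y) = 0"
    using integrable_pmf_bounded[of Y 1 q] Y by simp
  then show ?thesis
    using integrable_centered by simp
qed

lemma expectation_exp_centered:
  "measure_pmf.expectation q (\<lambda>x. exp (c * Y x)) = exp (c * measure_pmf.expectation q Y)
     * measure_pmf.expectation q (\<lambda>x. exp (c * (Y x - measure_pmf.expectation q Y)))"
  by (subst integral_mult_right_zero[symmetric]) (simp add: exp_add[symmetric] algebra_simps)

lemma integrable_exp_centered:
  "integrable (measure_pmf q) (\<lambda>x. exp (c * (Y x - measure_pmf.expectation q Y)))"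
  using integrable_exp_scaled[of c] by (simp add: right_diff_distrib exp_diff)

lemma variance_nonneg_le_1: "0 \<le> measure_pmf.variance q Y" "measure_pmf.variance q Y \<le> 1"
proof -
  show "0 \<le> measure_pmf.variance q Y" by simp
  have sq: "(Y x)\<^sup>2 \<le> 1" for x using Y[of x] by (simp add: abs_square_le_1)
  then have i: "integrable (measure_pmf q) (\<lambda>x. (Y x)\<^sup>2)"
    by (intro integrable_pmf_bounded[where c = 1]) auto
  have "measure_pmf.variance q Y
      = measure_pmf.expectation q (\<lambda>x. (Y x)\<^sup>2) - (measure_pmf.expectation q Y)\<^sup>2"
    by (rule measure_pmf.variance_eq[OF integrable_pmf_bounded[OF Y] i])
  also have "measure_pmf.expectation q (\<lambda>x. (Y x)\<^sup>2) \<le> 1"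
    using i sq by (intro measure_pmf.integral_le_const) auto
  finally show "measure_pmf.variance q Y \<le> 1"
    by (smt (verit) zero_le_power2)
qed

text \<open>After centring, the linear term of the quadratic lower bound vanishes in expectation.
  This leaves \<open>1 + z\<close> with \<open>z = l\<^sup>2 / 4 * v\<close>, which is at least
  \<open>exp (4 / 5 * z)\<close> for small \<open>z\<close>. The exponential form turns products
  over voters into sums of means and variances.\<close>

lemma mgf_lower_bound:
  fixes l :: real
  assumes l: "0 \<le> l" "l \<le> 1 / 2"
  shows "exp (- l * measure_pmf.expectation q Y + l\<^sup>2 / 5 * measure_pmf.variance q Y)
     \<le> measure_pmf.expectation q (\<lambda>x. exp (- l * Y x))"
proof -
  define a where "a = measure_pmf.expectation q Y"
  define v where "v = measure_pmf.variance q Y"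
  define z where "z = l\<^sup>2 / 4 * v"
  have v: "0 \<le> v" "v \<le> 1" using variance_nonneg_le_1 by (auto simp: v_def)
  have "l\<^sup>2 \<le> 1 / 4" using power_mono[OF l(2,1), of 2] by (simp add: power2_eq_square)
  then have z: "0 \<le> z" "z \<le> 1 / 16"
    using v mult_mono[of "l\<^sup>2 / 4" "1 / 16" v 1] by (auto simp: z_def)
  have "exp (4 / 5 * z) \<le> 1 + 4 / 5 * z + (4 / 5 * z)\<^sup>2"
    using z by (intro exp_bound) auto
  also have "(4 / 5 * z)\<^sup>2 \<le> z / 5"
    using mult_right_mono[OF z(2,1)] z by (simp add: power2_eq_square)
  finally have "exp (4 / 5 * z) \<le> 1 + z" by simp
  also have "1 + z = measure_pmf.expectation q
      (\<lambda>x. 1 + (- l) * (Y x - a) + l\<^sup>2 / 4 * (Y x - a)\<^sup>2)"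
    unfolding a_def by (subst expectation_quadratic) (simp add: z_def v_def)
  also have "\<dots> \<le> measure_pmf.expectation q (\<lambda>x. exp (- l * (Y x - a)))"
  proof (rule integral_mono)
    fix x
    have "\<bar>l * (Y x - a)\<bar> \<le> 1 / 2 * 2"
      unfolding abs_mult using l abs_centered_le_2[of x] by (intro mult_mono) (auto simp: a_def)
    then show "1 + (- l) * (Y x - a) + l\<^sup>2 / 4 * (Y x - a)\<^sup>2 \<le> exp (- l * (Y x - a))"
      using exp_quadratic_lower_bound[of "- l * (Y x - a)"] by (simp add: power_mult_distrib)
  qed (use integrable_centered integrable_exp_centered[of "- l"] in \<open>auto simp: a_def\<close>)
  finally have "exp (4 / 5 * z) \<le> measure_pmf.expectation q (\<lambda>x. exp (- l * (Y x - a)))" .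
  then have "exp (- l * a) * exp (4 / 5 * z)
      \<le> exp (- l * a) * measure_pmf.expectation q (\<lambda>x. exp (- l * (Y x - a)))"
    by (rule mult_left_mono) simp
  also have "\<dots> = measure_pmf.expectation q (\<lambda>x. exp (- l * Y x))"
    unfolding a_def by (rule expectation_exp_centered[symmetric])
  finally show ?thesis by (simp add: exp_add[symmetric] z_def a_def v_def)
qed

text \<open>The exponent is doubled because this is the second moment of
  \<open>exp (- l * Y x)\<close>; the constant 6 is 3 / 2 times the square of 2.\<close>

lemma mgf_upper_bound:
  fixes l :: real
  assumes l: "0 \<le> l" "l \<le> 1 / 2"
  shows "measure_pmf.expectation q (\<lambda>x. exp (- 2 * l * Y x))
     \<le> exp (- 2 * l * measure_pmf.expectation q Y + 6 * l\<^sup>2 * measure_pmf.variance q Y)"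
proof -
  define a where "a = measure_pmf.expectation q Y"
  define v where "v = measure_pmf.variance q Y"
  have "measure_pmf.expectation q (\<lambda>x. exp (- 2 * l * (Y x - a)))
      \<le> measure_pmf.expectation q
          (\<lambda>x. 1 + (- 2 * l) * (Y x - a) + 6 * l\<^sup>2 * (Y x - a)\<^sup>2)"
  proof (rule integral_mono)
    fix x
    have "\<bar>2 * l * (Y x - a)\<bar> \<le> 1 * 2"
      unfolding abs_mult using l abs_centered_le_2[of x] by (intro mult_mono) (auto simp: a_def)
    then show "exp (- 2 * l * (Y x - a)) \<le> 1 + (- 2 * l) * (Y x - a) + 6 * l\<^sup>2 * (Y x - a)\<^sup>2"
      using exp_bound_abs_le_2[of "- 2 * l * (Y x - a)"] by (simp add: power_mult_distrib)
  qed (use integrable_centered integrable_exp_centered[of "- 2 * l"] in \<open>auto simp: a_def\<close>)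
  also have "\<dots> = 1 + 6 * l\<^sup>2 * v"
    unfolding a_def v_def by (rule expectation_quadratic)
  also have "\<dots> \<le> exp (6 * l\<^sup>2 * v)" by simp
  finally have "exp (- 2 * l * a) * measure_pmf.expectation q (\<lambda>x. exp (- 2 * l * (Y x - a)))
      \<le> exp (- 2 * l * a) * exp (6 * l\<^sup>2 * v)"
    by (rule mult_left_mono) simp
  also have "exp (- 2 * l * a) * measure_pmf.expectation q (\<lambda>x. exp (- 2 * l * (Y x - a)))
      = measure_pmf.expectation q (\<lambda>x. exp (- 2 * l * Y x))"
    unfolding a_def by (rule expectation_exp_centered[symmetric])
  finally show ?thesis by (simp add: exp_add[symmetric] a_def v_def)
qed

end

section \<open>Rare non-positivity of an integer sum forces a large mean\<close>

text \<open>The bound rests on Cauchy--Schwarz in the form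
  \<open>E[exp(-l S); S \<le> 0]\<^sup>2 \<le> E[exp(-2 l S)] P(S \<le> 0)\<close>, while on \<open>S > 0\<close> integrality
  gives \<open>exp(-l S) \<le> exp(-l)\<close>.\<close>

lemma mgf_le_if_rarely_nonpos:
  fixes P :: "'a pmf" and S :: "'a \<Rightarrow> int" and l Q :: real
  assumes l: "0 \<le> l" and Q: "0 < Q"
    and int1: "integrable (measure_pmf P) (\<lambda>x. exp (- l * real_of_int (S x)))"
    and int2: "integrable (measure_pmf P) (\<lambda>x. exp (- 2 * l * real_of_int (S x)))"
    and M2: "measure_pmf.expectation P (\<lambda>x. exp (- 2 * l * real_of_int (S x)))
         \<le> (measure_pmf.expectation P (\<lambda>x. exp (- l * real_of_int (S x))))\<^sup>2 * Q"
    and M1: "0 < measure_pmf.expectation P (\<lambda>x. exp (- l * real_of_int (S x)))"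
    and rare: "measure_pmf.prob P {x. S x \<le> 0} \<le> 1 / (25 * Q)"
  shows "measure_pmf.expectation P (\<lambda>x. exp (- l * real_of_int (S x))) \<le> 5 / 4 * exp (- l)"
proof -
  define M where "M = measure_pmf.expectation P (\<lambda>x. exp (- l * real_of_int (S x)))"
  define N where "N = measure_pmf.expectation P (\<lambda>x. exp (- 2 * l * real_of_int (S x)))"
  define p where "p = measure_pmf.prob P {x. S x \<le> 0}"
  \<comment> \<open>Cauchy-Schwarz is carried out pointwise as
    \<open>e \<le> k / 2 * e\<^sup>2 + 1 / (2 * k)\<close>. This weight makes both error terms at
    most \<open>M / 10\<close> after integration, so
    \<open>M \<le> exp (- l) + M / 5\<close>.\<close>
  define k where "k = 1 / (5 * Q * M)"
  have M: "0 < M" using M1 by (simp add: M_def)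
  have k: "0 < k" using M Q by (simp add: k_def)
  have pointwise: "exp (- l * real_of_int (S x))
      \<le> exp (- l) + k / 2 * exp (- 2 * l * real_of_int (S x))
        + 1 / (2 * k) * indicator {x. S x \<le> 0} x" for x
  proof (cases "S x \<le> 0")
    case True
    define e where "e = exp (- l * real_of_int (S x))"
    have "0 \<le> (k * e - 1)\<^sup>2 / (2 * k)" using k by simp
    also have "\<dots> = k / 2 * e\<^sup>2 + 1 / (2 * k) - e"
      using k by (simp add: power2_eq_square field_simps)
    finally have "e \<le> exp (- l) + k / 2 * e\<^sup>2 + 1 / (2 * k)"
      using exp_ge_zero[of "- l"] by linarith
    moreover have "e\<^sup>2 = exp (- 2 * l * real_of_int (S x))"
      by (simp add: e_def power2_eq_square exp_add[symmetric])
    ultimately show ?thesis using True by (simp add: e_def)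
  next
    case False
    then have "l * 1 \<le> l * real_of_int (S x)" using l by (intro mult_left_mono) auto
    then have "exp (- l * real_of_int (S x)) \<le> exp (- l)" by simp
    then show ?thesis using False k by (simp add: add_increasing2)
  qed
  have int3: "integrable (measure_pmf P) (indicat_real {x. S x \<le> 0})"
    by (rule integrable_pmf_bounded[where c = 1]) (simp add: indicator_def)
  have "M \<le> measure_pmf.expectation P (\<lambda>x. exp (- l)
      + k / 2 * exp (- 2 * l * real_of_int (S x)) + 1 / (2 * k) * indicator {x. S x \<le> 0} x)"
    unfolding M_def using pointwise
    by (intro integral_mono Bochner_Integration.integrable_add integrable_mult_right
          int1 int2 int3) auto
  also have "\<dots> = exp (- l) + k / 2 * N + 1 / (2 * k) * p"
    using int2 int3 by (simp add: N_def p_def)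
  also have "\<dots> \<le> exp (- l) + k / 2 * (M\<^sup>2 * Q) + 1 / (2 * k) * (1 / (25 * Q))"
    using M2 rare k unfolding N_def M_def p_def by (intro add_mono mult_left_mono) auto
  also have "\<dots> = exp (- l) + M / 5"
    using M Q by (simp add: k_def field_simps power2_eq_square)
  finally show ?thesis unfolding M_def by simp
qed

context
  fixes A :: "'i set" and d :: 'a and p :: "'i \<Rightarrow> 'a pmf" and Y :: "'a \<Rightarrow> int"
  assumes A: "finite A" and Y: "\<And>x. \<bar>Y x\<bar> \<le> 1"
begin

lemma integrable_exp_sum_Pi_pmf:
  "integrable (measure_pmf (Pi_pmf A d p)) (\<lambda>v. exp (c * real_of_int (\<Sum>t\<in>A. Y (v t))))"
proof (rule integrable_pmf_bounded)
  fix v :: "'i \<Rightarrow> 'a"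
  have "\<bar>\<Sum>t\<in>A. Y (v t)\<bar> \<le> (\<Sum>t\<in>A. 1)"
    using Y by (intro order.trans[OF sum_abs] sum_mono) auto
  then have *: "\<bar>real_of_int (\<Sum>t\<in>A. Y (v t))\<bar> \<le> real (card A)"
    by (metis of_int_abs of_int_le_iff of_int_of_nat_eq sum_constant mult.right_neutral
        of_nat_eq_id id_apply)
  have "c * real_of_int (\<Sum>t\<in>A. Y (v t)) \<le> \<bar>c * real_of_int (\<Sum>t\<in>A. Y (v t))\<bar>"
    by (rule abs_ge_self)
  also have "\<dots> \<le> \<bar>c\<bar> * real (card A)"
    unfolding abs_mult using * by (intro mult_left_mono) auto
  finally show "\<bar>exp (c * real_of_int (\<Sum>t\<in>A. Y (v t)))\<bar> \<le> exp (\<bar>c\<bar> * real (card A))" by simp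
qed

lemma expectation_exp_sum_Pi_pmf:
  "measure_pmf.expectation (Pi_pmf A d p) (\<lambda>v. exp (c * real_of_int (\<Sum>t\<in>A. Y (v t))))
     = (\<Prod>t\<in>A. measure_pmf.expectation (p t) (\<lambda>x. exp (c * real_of_int (Y x))))"
proof -
  have "\<bar>real_of_int (Y x)\<bar> \<le> 1" for x using Y[of x] by linarith
  then have "integrable (measure_pmf (p t)) (\<lambda>x. exp (c * real_of_int (Y x)))" for t
    by (intro integrable_exp_scaled) auto
  then have "measure_pmf.expectation (Pi_pmf A d p) (\<lambda>v. \<Prod>t\<in>A. exp (c * real_of_int (Y (v t))))
     = (\<Prod>t\<in>A. measure_pmf.expectation (p t) (\<lambda>x. exp (c * real_of_int (Y x))))"
    by (intro expectation_prod_Pi_pmf[OF A]) auto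
  then show ?thesis by (simp add: sum_distrib_left exp_sum[OF A])
qed

text \<open>The two bounds on moment generating functions show that the second moment exceeds the
  squared first moment by a factor of at most \<open>exp (6 * l\<^sup>2 * V)\<close>, which serves
  as \<open>Q\<close>. The claim then compares the logarithms of the lower and upper bounds on the
  first moment. The summand \<open>l\<close> comes from integrality, and \<open>1 / 4\<close> from
  \<open>5 / 4 \<le> exp (1 / 4)\<close>.\<close>

lemma mean_bound_if_rarely_nonpos:
  fixes l :: real
  defines "\<mu> \<equiv> \<Sum>t\<in>A. measure_pmf.expectation (p t) (\<lambda>x. real_of_int (Y x))"
    and "V \<equiv> \<Sum>t\<in>A. measure_pmf.variance (p t) (\<lambda>x. real_of_int (Y x))"
  assumes l: "0 \<le> l" "l \<le> 1 / 2"
    and rare: "measure_pmf.prob (Pi_pmf A d p) {v. (\<Sum>t\<in>A. Y (v t)) \<le> 0}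
      \<le> exp (- 6 * l\<^sup>2 * V) / 25"
  shows "l * \<mu> \<ge> l\<^sup>2 / 5 * V + l - 1 / 4"
proof -
  let ?E = "\<lambda>c. measure_pmf.expectation (Pi_pmf A d p)
    (\<lambda>v. exp (c * real_of_int (\<Sum>t\<in>A. Y (v t))))"
  have Y': "\<bar>real_of_int (Y x)\<bar> \<le> 1" for x using Y[of x] by linarith
  have "exp (- l * \<mu> + l\<^sup>2 / 5 * V) = (\<Prod>t\<in>A.
      exp (- l * measure_pmf.expectation (p t) (\<lambda>x. real_of_int (Y x))
      + l\<^sup>2 / 5 * measure_pmf.variance (p t) (\<lambda>x. real_of_int (Y x))))"
    unfolding \<mu>_def V_def by (simp only: exp_sum[OF A, symmetric] sum.distrib sum_distrib_left)
  also have "\<dots> \<le> ?E (- l)"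
    unfolding expectation_exp_sum_Pi_pmf
    by (intro prod_mono conjI mgf_lower_bound Y' l) auto
  finally have lower: "exp (- l * \<mu> + l\<^sup>2 / 5 * V) \<le> ?E (- l)" .
  have "?E (- 2 * l) \<le> (\<Prod>t\<in>A.
      exp (- 2 * l * measure_pmf.expectation (p t) (\<lambda>x. real_of_int (Y x))
      + 6 * l\<^sup>2 * measure_pmf.variance (p t) (\<lambda>x. real_of_int (Y x))))"
    unfolding expectation_exp_sum_Pi_pmf
    by (intro prod_mono conjI mgf_upper_bound Y' l integral_nonneg) auto
  also have "\<dots> = exp (- 2 * l * \<mu> + 6 * l\<^sup>2 * V)"
    unfolding \<mu>_def V_def by (simp only: exp_sum[OF A, symmetric] sum.distrib sum_distrib_left)
  also have "\<dots> = (exp (- l * \<mu>))\<^sup>2 * exp (6 * l\<^sup>2 * V)"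
    by (simp add: power2_eq_square exp_add[symmetric])
  also have "\<dots> \<le> (?E (- l))\<^sup>2 * exp (6 * l\<^sup>2 * V)"
  proof (intro mult_right_mono power_mono)
    have "0 \<le> V" unfolding V_def by (intro sum_nonneg) simp
    then have "exp (- l * \<mu>) \<le> exp (- l * \<mu> + l\<^sup>2 / 5 * V)" by simp
    then show "exp (- l * \<mu>) \<le> ?E (- l)" using lower by (rule order.trans)
  qed auto
  finally have "?E (- 2 * l) \<le> (?E (- l))\<^sup>2 * exp (6 * l\<^sup>2 * V)" .
  then have "?E (- l) \<le> 5 / 4 * exp (- l)"
  \<comment> \<open>The rotation puts the second-moment premise first, so that the chained fact
    determines \<open>Q\<close>.\<close>
  proof (rule mgf_le_if_rarely_nonpos[rotated 4])
    show "0 < ?E (- l)" using lower by (rule order.strict_trans2[rotated]) simp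
    show "measure_pmf.prob (Pi_pmf A d p) {v. (\<Sum>t\<in>A. Y (v t)) \<le> 0} \<le> 1 / (25 * exp (6 * l\<^sup>2 * V))"
      using rare by (simp add: exp_minus field_simps)
  qed (use l integrable_exp_sum_Pi_pmf[of "- l"] integrable_exp_sum_Pi_pmf[of "- 2 * l"]
      in \<open>auto simp del: of_int_sum\<close>)
  also have "\<dots> \<le> exp (1 / 4) * exp (- l)"
    using exp_ge_add_one_self[of "1 / 4 :: real"] by (intro mult_right_mono) auto
  finally have "exp (- l * \<mu> + l\<^sup>2 / 5 * V) \<le> exp (1 / 4) * exp (- l)"
    by (rule order.trans[OF lower])
  then have "exp (- l * \<mu> + l\<^sup>2 / 5 * V) \<le> exp (1 / 4 - l)"
    by (simp add: exp_add[symmetric])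
  then show ?thesis by simp
qed

text \<open>The optimal \<open>l\<close> is the square root of \<open>L / (6 V)\<close>, capped at \<open>1 / 2\<close>: this is what
  separates the Poissonian from the Gaussian regime.\<close>

lemma mean_lower_bound_if_rarely_nonpos:
  fixes L :: real
  defines "\<mu> \<equiv> \<Sum>t\<in>A. measure_pmf.expectation (p t) (\<lambda>x. real_of_int (Y x))"
    and "V \<equiv> \<Sum>t\<in>A. measure_pmf.variance (p t) (\<lambda>x. real_of_int (Y x))"
  assumes L: "15 \<le> L"
    and rare: "measure_pmf.prob (Pi_pmf A d p) {v. (\<Sum>t\<in>A. Y (v t)) \<le> 0} \<le> exp (- L) / 25"
  shows "0 < \<mu> \<and> (1 / 2 + V / 10 \<le> \<mu> \<or> L * V / 600 \<le> \<mu>\<^sup>2)"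
proof -
  have V0: "0 \<le> V" unfolding V_def by (intro sum_nonneg) simp
  have bound: "l * \<mu> \<ge> l\<^sup>2 / 5 * V + l - 1 / 4" if "0 \<le> l" "l \<le> 1 / 2" "6 * l\<^sup>2 * V \<le> L" for l
    unfolding \<mu>_def V_def using that
    by (intro mean_bound_if_rarely_nonpos order.trans[OF rare]) (auto simp: V_def)
  show ?thesis
  proof (cases "V \<le> 2 * L / 3")
    case True
    \<comment> \<open>The cap \<open>l = 1 / 2\<close> is admissible exactly when
      \<open>V \<le> 2 * L / 3\<close>.\<close>
    then have "1 / 2 + V / 10 \<le> \<mu>" using bound[of "1 / 2"] by (simp add: power2_eq_square)
    then show ?thesis using V0 by auto
  next
    case False
    define l where "l = sqrt (L / (6 * V))"
    have V: "0 < V" using False L by auto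
    have l: "0 < l" "l\<^sup>2 = L / (6 * V)" using V L by (auto simp: l_def)
    have "l\<^sup>2 \<le> (1 / 2)\<^sup>2" unfolding l(2) using V False by (simp add: field_simps)
    then have "l \<le> 1 / 2" by (rule power2_le_imp_le) simp
    then have "l * \<mu> \<ge> l\<^sup>2 / 5 * V + l - 1 / 4" using l V by (intro bound) auto
    also have "l\<^sup>2 / 5 * V = L / 30" using V by (simp add: l(2))
    \<comment> \<open>The threshold 15 originates here: it makes half of \<open>L / 30\<close>
      absorb the loss \<open>1 / 4\<close>.\<close>
    finally have *: "L / 60 \<le> l * \<mu>" using L l(1) by simp
    then have "0 < l * \<mu>" using L by linarith
    then have "0 < \<mu>" using l(1) by (simp add: zero_less_mult_iff)
    have "(L / 60)\<^sup>2 \<le> (l * \<mu>)\<^sup>2" using * L by (intro power_mono) auto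
    also have "\<dots> = L / (6 * V) * \<mu>\<^sup>2" by (simp add: power_mult_distrib l(2))
    finally have "L * (L * V / 600) \<le> L * \<mu>\<^sup>2"
      using V by (simp add: field_simps power2_eq_square)
    then have "L * V / 600 \<le> \<mu>\<^sup>2" using L by simp
    then show ?thesis using \<open>0 < \<mu>\<close> by simp
  qed
qed

end

section \<open>Colour-dependent votes are noisy\<close>

context
  fixes n :: nat and \<epsilon> :: real
  assumes n: "2 \<le> n" and \<epsilon>: "0 < \<epsilon>" "\<epsilon> \<le> 1 / (11 * (real n - 1))"
begin

text \<open>These bounds also keep the truncation inside \<open>bernoulli_pmf\<close> inactive, on
  which the affine formula for \<open>vote_pmf\<close> relies.\<close>

lemma blue_fraction_bounds:
  assumes "i \<in> {1..n}"
  shows "5 / 11 \<le> blue_fraction n \<epsilon> i" "blue_fraction n \<epsilon> i \<le> 6 / 11"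
proof -
  have 1: "\<epsilon> * (real n - 1) \<le> 1 / 11" using n \<epsilon> by (simp add: field_simps)
  have 2: "0 \<le> (real i - 1) * \<epsilon>" "(real i - 1) * \<epsilon> \<le> \<epsilon> * (real n - 1)"
    using assms \<epsilon>(1) by auto
  show "5 / 11 \<le> blue_fraction n \<epsilon> i" "blue_fraction n \<epsilon> i \<le> 6 / 11"
    unfolding blue_fraction_def using 1 2 by (auto simp: field_simps)
qed

lemma pmf_vote_pmf:
  assumes "i \<in> {1..n}"
  shows "pmf (vote_pmf n \<epsilon> R B i t) j = pmf (R t) j
    + blue_fraction n \<epsilon> i * (pmf (B t) j - pmf (R t) j)"
  unfolding vote_pmf_def pmf_bind
  using blue_fraction_bounds[OF assms] by (simp add: algebra_simps)

text \<open>The probability \<open>q\<close> mixes \<open>r\<close> and \<open>b\<close> with both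
  weights at least 5 / 11, so it stays at distance \<open>u\<close> from 0 and from 1. Since
  \<open>u \<le> 5 / 11\<close>, the variance is at least \<open>u * (6 / 11)\<close>, and 30 / 121
  exceeds 1 / 5.\<close>

lemma indicator_variance_ge_colour_dependence:
  fixes R B :: "nat \<Rightarrow> nat pmf" and i j t :: nat
  assumes "i \<in> {1..n}"
  defines "q \<equiv> pmf (vote_pmf n \<epsilon> R B i t) j"
  shows "\<bar>pmf (B t) j - pmf (R t) j\<bar> / 5 \<le> q * (1 - q)"
proof -
  define x where "x = blue_fraction n \<epsilon> i"
  define r where "r = pmf (R t) j"
  define b where "b = pmf (B t) j"
  define u where "u = 5 / 11 * \<bar>b - r\<bar>"
  have x: "5 / 11 \<le> x" "x \<le> 6 / 11" using blue_fraction_bounds[OF assms(1)] by (auto simp: x_def)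
  have rb: "0 \<le> r" "r \<le> 1" "0 \<le> b" "b \<le> 1" by (auto simp: r_def b_def pmf_le_1)
  have q: "q = r + x * (b - r)" using pmf_vote_pmf[OF assms(1)] by (simp add: q_def x_def r_def b_def)
  have "u \<le> q \<and> q \<le> 1 - u"
  proof (cases "r \<le> b")
    case True
    define w where "w = x * (b - r)"
    have "5 / 11 * (b - r) \<le> w" "w \<le> 6 / 11 * (b - r)"
      unfolding w_def using x True by (intro mult_right_mono; simp)+
    moreover have "q = r + w" by (simp add: q w_def)
    moreover have "11 * u = 5 * (b - r)" using True by (simp add: u_def)
    ultimately have "11 * u \<le> 11 * q" "11 * q \<le> 11 - 11 * u" using rb True by argo+
    then show ?thesis by simp
  next
    case False
    define w where "w = x * (r - b)"
    have "5 / 11 * (r - b) \<le> w" "w \<le> 6 / 11 * (r - b)"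
      unfolding w_def using x False by (intro mult_right_mono; simp)+
    moreover have "q = r - w" by (simp add: q w_def algebra_simps)
    moreover have "11 * u = 5 * (r - b)" using False by (simp add: u_def)
    ultimately have "11 * u \<le> 11 * q" "11 * q \<le> 11 - 11 * u" using rb False by argo+
    then show ?thesis by simp
  qed
  then have "0 \<le> (q - u) * (1 - u - q)" by simp
  then have "u * (1 - u) \<le> q * (1 - q)" by (simp add: algebra_simps)
  moreover have "u * (6 / 11) \<le> u * (1 - u)"
    using rb by (intro mult_left_mono) (auto simp: u_def)
  ultimately have "u * (6 / 11) \<le> q * (1 - q)" by (rule order.trans[rotated])
  moreover have "\<bar>b - r\<bar> / 5 \<le> u * (6 / 11)" by (simp add: u_def)
  ultimately show ?thesis unfolding b_def r_def by (rule order.trans[rotated])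
qed

end

text \<open>Votes for \<open>i\<close> and for \<open>j\<close> exclude each other, so their
  indicators are negatively correlated and subtracting one from the other only adds
  variance.\<close>

lemma vote_difference_moments:
  fixes q :: "nat pmf"
  assumes "i \<noteq> j"
  defines "Y \<equiv> \<lambda>v. real_of_int (of_bool (v = j) - of_bool (v = i))"
  shows "measure_pmf.expectation q Y = pmf q j - pmf q i"
    and "pmf q j * (1 - pmf q j) \<le> measure_pmf.variance q Y"
proof -
  have int: "integrable (measure_pmf q) (indicat_real {k})" for k
    by (rule integrable_pmf_bounded[where c = 1]) (simp add: indicator_def)
  have Y: "Y = (\<lambda>v. indicat_real {j} v - indicat_real {i} v)"
    by (auto simp: Y_def indicator_def fun_eq_iff)
  have Y2: "(\<lambda>v. (Y v)\<^sup>2) = (\<lambda>v. indicat_real {j} v + indicat_real {i} v)"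
    using assms(1) by (auto simp: Y indicator_def fun_eq_iff)
  show E: "measure_pmf.expectation q Y = pmf q j - pmf q i"
    using int by (simp add: Y measure_pmf_single)
  have "measure_pmf.variance q Y
      = measure_pmf.expectation q (\<lambda>v. (Y v)\<^sup>2) - (measure_pmf.expectation q Y)\<^sup>2"
    using int by (intro measure_pmf.variance_eq) (simp_all only: Y2, simp_all add: Y)
  also have "\<dots> = pmf q j + pmf q i - (pmf q j - pmf q i)\<^sup>2"
    unfolding E Y2 using int by (simp add: measure_pmf_single)
  also have "\<dots> = pmf q j * (1 - pmf q j) + pmf q i * (1 - pmf q i) + 2 * (pmf q i * pmf q j)"
    by (simp add: algebra_simps power2_eq_square)
  also have "\<dots> \<ge> pmf q j * (1 - pmf q j)"
  proof -
    have "0 \<le> pmf q i * (1 - pmf q i)" "0 \<le> pmf q i * pmf q j" by (auto simp: pmf_le_1)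
    then show ?thesis by linarith
  qed
  finally show "pmf q j * (1 - pmf q j) \<le> measure_pmf.variance q Y" .
qed

section \<open>Slopes and the margins between neighbouring urns\<close>

text \<open>The expected number of votes for urn \<open>j\<close> is an affine function of the blue fraction of
  the correct urn; this is its slope.\<close>

definition vote_slope :: "nat \<Rightarrow> (nat \<Rightarrow> nat pmf) \<Rightarrow> (nat \<Rightarrow> nat pmf) \<Rightarrow> nat \<Rightarrow> real" where
  "vote_slope m R B j = (\<Sum>t\<in>{1..m}. pmf (B t) j - pmf (R t) j)"

text \<open>Both vectors of a voter have total weight 1, so each voter contributes at most 2. This
  is where the number of voters enters the argument.\<close>

lemma sum_abs_vote_slope_le:
  assumes "plurality_scheme n m R B"
  shows "(\<Sum>j\<in>{1..n}. \<bar>vote_slope m R B j\<bar>) \<le> 2 * real m"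
proof -
  have "(\<Sum>j\<in>{1..n}. \<bar>vote_slope m R B j\<bar>)
      \<le> (\<Sum>j\<in>{1..n}. \<Sum>t\<in>{1..m}. pmf (B t) j + pmf (R t) j)"
    unfolding vote_slope_def
  proof (intro sum_mono order.trans[OF sum_abs])
    fix j t
    show "\<bar>pmf (B t) j - pmf (R t) j\<bar> \<le> pmf (B t) j + pmf (R t) j"
      using pmf_nonneg[of "B t" j] pmf_nonneg[of "R t" j] by linarith
  qed
  also have "\<dots> = (\<Sum>t\<in>{1..m}. (\<Sum>j\<in>{1..n}. pmf (B t) j) + (\<Sum>j\<in>{1..n}. pmf (R t) j))"
    by (subst sum.swap) (simp add: sum.distrib)
  also have "\<dots> = (\<Sum>t\<in>{1..m}. 2)"
    using assms by (intro sum.cong refl) (auto simp: plurality_scheme_def sum_pmf_eq_1)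
  finally show ?thesis by simp
qed

text \<open>This is the lower bound on the mean margin with the variance replaced by a fifth of the
  absolute slope \<open>s\<close>: the first alternative is Poissonian, the second Gaussian.
  Positivity of \<open>\<mu>\<close> makes the predicate monotone in \<open>\<mu>\<close> despite
  the square.\<close>

definition sufficient_margin :: "real \<Rightarrow> real \<Rightarrow> real \<Rightarrow> bool" where
  "sufficient_margin L \<mu> s \<longleftrightarrow> 0 < \<mu> \<and> (1 / 2 + s / 50 \<le> \<mu> \<or> L * s / 3000 \<le> \<mu>\<^sup>2)"

lemma sufficient_margin_mono:
  assumes "sufficient_margin L \<mu> s" "\<mu> \<le> \<nu>"
  shows "sufficient_margin L \<nu> s"
proof -
  have "\<mu>\<^sup>2 \<le> \<nu>\<^sup>2" using assms by (intro power_mono) (auto simp: sufficient_margin_def)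
  then show ?thesis using assms unfolding sufficient_margin_def by linarith
qed

text \<open>A nonpositive margin of \<open>j\<close> over \<open>i\<close>, ties included, already
  makes \<open>j\<close> fail, and the variance of the margin is bounded below voter by
  voter.\<close>

lemma sufficient_margin_if_rarely_fails:
  fixes L :: real
  assumes n: "2 \<le> n" and \<epsilon>: "0 < \<epsilon>" "\<epsilon> \<le> 1 / (11 * (real n - 1))"
    and ij: "i \<in> {1..n}" "j \<in> {1..n}" "i \<noteq> j"
    and L: "15 \<le> L" and fail: "failure_prob n \<epsilon> m R B j \<le> exp (- L) / 25"
  shows "sufficient_margin L
    (\<Sum>t\<in>{1..m}. pmf (vote_pmf n \<epsilon> R B j t) j - pmf (vote_pmf n \<epsilon> R B j t) i)
    \<bar>vote_slope m R B j\<bar>"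
proof -
  define Y where "Y = (\<lambda>v. of_bool (v = j) - of_bool (v = i) :: int)"
  define p where "p = vote_pmf n \<epsilon> R B j"
  define s where "s = \<bar>vote_slope m R B j\<bar>"
  define \<mu> where "\<mu> = (\<Sum>t\<in>{1..m}. measure_pmf.expectation (p t) (\<lambda>x. real_of_int (Y x)))"
  define V where "V = (\<Sum>t\<in>{1..m}. measure_pmf.variance (p t) (\<lambda>x. real_of_int (Y x)))"
  have margin: "(\<Sum>t\<in>{1..m}. Y (v t)) = int (votes m v j) - int (votes m v i)" for v
    by (simp add: Y_def votes_def sum_subtractf of_bool_def sum.If_cases Int_def)
  have "measure_pmf.prob (Pi_pmf {1..m} 0 p) {v. (\<Sum>t\<in>{1..m}. Y (v t)) \<le> 0}
      \<le> failure_prob n \<epsilon> m R B j"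
    unfolding failure_prob_def ballots_pmf_def p_def margin plurality_winner_def using ij
    by (intro measure_pmf.finite_measure_mono) (auto simp: not_less)
  then have rare: "measure_pmf.prob (Pi_pmf {1..m} 0 p) {v. (\<Sum>t\<in>{1..m}. Y (v t)) \<le> 0}
      \<le> exp (- L) / 25"
    using fail by linarith
  have *: "0 < \<mu> \<and> (1 / 2 + V / 10 \<le> \<mu> \<or> L * V / 600 \<le> \<mu>\<^sup>2)"
    unfolding \<mu>_def V_def
    by (rule mean_lower_bound_if_rarely_nonpos[OF _ _ L rare]) (auto simp: Y_def)
  have "s \<le> (\<Sum>t\<in>{1..m}. \<bar>pmf (B t) j - pmf (R t) j\<bar>)"
    unfolding s_def vote_slope_def by (rule sum_abs)
  also have "\<dots> \<le> (\<Sum>t\<in>{1..m}. 5 * measure_pmf.variance (p t) (\<lambda>x. real_of_int (Y x)))"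
  proof (rule sum_mono)
    fix t
    have "\<bar>pmf (B t) j - pmf (R t) j\<bar> / 5 \<le> measure_pmf.variance (p t) (\<lambda>x. real_of_int (Y x))"
      unfolding p_def Y_def
      using indicator_variance_ge_colour_dependence[OF n \<epsilon> ij(2)] vote_difference_moments(2)[OF ij(3)]
      by (rule order.trans)
    then show "\<bar>pmf (B t) j - pmf (R t) j\<bar>
        \<le> 5 * measure_pmf.variance (p t) (\<lambda>x. real_of_int (Y x))" by simp
  qed
  finally have V: "s / 5 \<le> V" by (simp add: V_def flip: sum_distrib_left)
  have "L * (s / 5) \<le> L * V" using V L by (intro mult_left_mono) auto
  then have "sufficient_margin L \<mu> s" using * V unfolding sufficient_margin_def by auto
  then show ?thesis
    unfolding \<mu>_def s_def p_def Y_def using vote_difference_moments(1)[OF ij(3)] by simp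
qed

text \<open>The mean margin of urn \<open>Suc i\<close> over urn \<open>i\<close> is positive if the
  former is correct and negative if the latter is. Its total change \<open>\<delta>\<close>
  therefore dominates both absolute values. The two conclusions serve the upward and the downward
  traversal of the urns.\<close>

lemma vote_slope_increment:
  fixes L :: real and R B :: "nat \<Rightarrow> nat pmf"
  assumes n: "2 \<le> n" and \<epsilon>: "0 < \<epsilon>" "\<epsilon> \<le> 1 / (11 * (real n - 1))"
    and i: "1 \<le> i" "i < n" and L: "15 \<le> L"
    and fail: "\<And>j. j \<in> {1..n} \<Longrightarrow> failure_prob n \<epsilon> m R B j \<le> exp (- L) / 25"
  defines "\<delta> \<equiv> \<epsilon> * (vote_slope m R B (Suc i) - vote_slope m R B i)"
  shows "sufficient_margin L \<delta> \<bar>vote_slope m R B (Suc i)\<bar>"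
    and "sufficient_margin L \<delta> \<bar>vote_slope m R B i\<bar>"
proof -
  define a where "a = (\<Sum>t\<in>{1..m}. pmf (R t) (Suc i) - pmf (R t) i)"
  define b where "b = vote_slope m R B (Suc i) - vote_slope m R B i"
  define \<mu> where "\<mu> = (\<lambda>k. a + blue_fraction n \<epsilon> k * b)"
  have \<mu>: "(\<Sum>t\<in>{1..m}. pmf (vote_pmf n \<epsilon> R B k t) (Suc i) - pmf (vote_pmf n \<epsilon> R B k t) i) = \<mu> k"
    if "k \<in> {1..n}" for k
    unfolding \<mu>_def a_def b_def vote_slope_def
    by (simp add: pmf_vote_pmf[OF n \<epsilon> that] algebra_simps sum.distrib sum_subtractf sum_distrib_left)
  have in_range: "i \<in> {1..n}" "Suc i \<in> {1..n}" using i by auto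
  have 1: "sufficient_margin L (\<mu> (Suc i)) \<bar>vote_slope m R B (Suc i)\<bar>"
    using sufficient_margin_if_rarely_fails[OF n \<epsilon> in_range _ L fail[OF in_range(2)]]
    by (simp add: \<mu>[OF in_range(2), symmetric])
  have "- \<mu> i = (\<Sum>t\<in>{1..m}. pmf (vote_pmf n \<epsilon> R B i t) i - pmf (vote_pmf n \<epsilon> R B i t) (Suc i))"
    unfolding \<mu>[OF in_range(1), symmetric] by (simp add: sum_subtractf)
  then have 2: "sufficient_margin L (- \<mu> i) \<bar>vote_slope m R B i\<bar>"
    using sufficient_margin_if_rarely_fails[OF n \<epsilon> in_range(2,1) _ L fail[OF in_range(1)]] by simp
  have "\<mu> (Suc i) + - \<mu> i = \<delta>"
    by (simp add: \<mu>_def \<delta>_def b_def blue_fraction_def algebra_simps)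
  moreover have "0 < \<mu> (Suc i)" "0 < - \<mu> i" using 1 2 by (auto simp: sufficient_margin_def)
  ultimately have "\<mu> (Suc i) \<le> \<delta>" "- \<mu> i \<le> \<delta>" by linarith+
  then show "sufficient_margin L \<delta> \<bar>vote_slope m R B (Suc i)\<bar>"
    "sufficient_margin L \<delta> \<bar>vote_slope m R B i\<bar>"
    using 1 2 sufficient_margin_mono by blast+
qed

section \<open>Growth of the slopes along the urns\<close>

text \<open>This is a discrete form of \<open>\<epsilon> * f' \<ge> sqrt (L * f / 3000)\<close>,
  whose positive solutions grow quadratically; hence the induction tracks \<open>sqrt (f k)\<close>,
  which gains a fixed amount per step.\<close>

lemma quadratic_growth:
  fixes f :: "nat \<Rightarrow> real" and L \<epsilon> :: real
  assumes \<epsilon>: "0 < \<epsilon>" "\<epsilon> \<le> 1 / 50" and L: "0 < L" and f0: "0 \<le> f 0"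
    and step: "\<And>k. k < N \<Longrightarrow> sufficient_margin L (\<epsilon> * (f (Suc k) - f k)) \<bar>f (Suc k)\<bar>"
  shows "k \<le> N \<Longrightarrow> 0 \<le> f k \<and> real k * (sqrt (L / 12000) / \<epsilon>) \<le> sqrt (f k)"
proof (induction k)
  case 0
  then show ?case using f0 by simp
next
  case (Suc k)
  define x where "x = f k"
  define y where "y = f (Suc k)"
  have x: "0 \<le> x" and IH: "real k * (sqrt (L / 12000) / \<epsilon>) \<le> sqrt x"
    using Suc by (auto simp: x_def)
  have G: "sufficient_margin L (\<epsilon> * (y - x)) \<bar>y\<bar>"
    using step[of k] Suc.prems by (simp add: x_def y_def)
  then have xy: "x < y" using \<epsilon> by (simp add: sufficient_margin_def zero_less_mult_iff)
  \<comment> \<open>The Poissonian alternative is excluded: so small an \<open>\<epsilon>\<close>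
    cannot produce the extra 1 / 2.\<close>
  have "\<epsilon> * (y - x) \<le> 1 / 50 * \<bar>y\<bar>" using \<epsilon> x xy by (intro mult_mono) auto
  then have "\<not> 1 / 2 + \<bar>y\<bar> / 50 \<le> \<epsilon> * (y - x)" by linarith
  then have "L * y / 3000 \<le> (\<epsilon> * (y - x))\<^sup>2"
    using G x xy by (auto simp: sufficient_margin_def)
  then have "sqrt (L * y / 3000) \<le> \<epsilon> * (y - x)"
    using \<epsilon> xy by (intro real_le_lsqrt) auto
  moreover have "sqrt (L * y / 3000) = 2 * sqrt (L / 12000) * sqrt y"
  proof -
    have "L * y / 3000 = 2\<^sup>2 * (L / 12000) * y" by simp
    then show ?thesis by (simp only: real_sqrt_mult real_sqrt_abs abs_numeral)
  qed
  moreover have "\<epsilon> * (y - x) = \<epsilon> * (sqrt y - sqrt x) * (sqrt y + sqrt x)"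
    using x xy by (simp add: algebra_simps)
  \<comment> \<open>Because the margin is measured at the new value \<open>y\<close>, the factor
    \<open>2 * sqrt y\<close> appears on both sides and cancels; its 2 turns 3000 into
    12000.\<close>
  moreover have "\<epsilon> * (sqrt y - sqrt x) * (sqrt y + sqrt x) \<le> \<epsilon> * (sqrt y - sqrt x) * (2 * sqrt y)"
    using \<epsilon> x xy by (intro mult_left_mono) auto
  ultimately have "2 * sqrt (L / 12000) * sqrt y \<le> \<epsilon> * (sqrt y - sqrt x) * (2 * sqrt y)"
    by linarith
  then have "(2 * sqrt y) * sqrt (L / 12000) \<le> (2 * sqrt y) * (\<epsilon> * (sqrt y - sqrt x))"
    by (simp only: mult_ac)
  then have "sqrt (L / 12000) \<le> \<epsilon> * (sqrt y - sqrt x)"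
    using x xy by simp
  then have "sqrt (L / 12000) / \<epsilon> \<le> sqrt y - sqrt x"
    using \<epsilon> by (simp add: field_simps)
  moreover have "real (Suc k) * (sqrt (L / 12000) / \<epsilon>)
      = real k * (sqrt (L / 12000) / \<epsilon>) + sqrt (L / 12000) / \<epsilon>"
    by (simp add: distrib_right add_divide_distrib)
  ultimately show ?case using IH x xy unfolding y_def[symmetric] by linarith
qed

lemma cube_le_3_sum_squares: "real N ^ 3 \<le> 3 * (\<Sum>k\<in>{..N}. (real k)\<^sup>2)"
proof (induction N)
  case (Suc N)
  then show ?case by (simp add: power2_eq_square power3_eq_cube algebra_simps)
qed simp

lemma cubic_growth_of_sum:
  fixes f :: "nat \<Rightarrow> real" and L \<epsilon> :: real
  assumes \<epsilon>: "0 < \<epsilon>" "\<epsilon> \<le> 1 / 50" and L: "0 < L" and f0: "0 \<le> f 0"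
    and step: "\<And>k. k < N \<Longrightarrow> sufficient_margin L (\<epsilon> * (f (Suc k) - f k)) \<bar>f (Suc k)\<bar>"
  shows "L / (36000 * \<epsilon>\<^sup>2) * real N ^ 3 \<le> (\<Sum>k\<in>{..N}. \<bar>f k\<bar>)"
proof -
  \<comment> \<open>The constant 36000 is 12000 times the 3 from the sum of squares.\<close>
  have "L / (36000 * \<epsilon>\<^sup>2) * real N ^ 3 \<le> L / (36000 * \<epsilon>\<^sup>2) * (3 * (\<Sum>k\<in>{..N}. (real k)\<^sup>2))"
    using L by (intro mult_left_mono cube_le_3_sum_squares) auto
  also have "\<dots> = (\<Sum>k\<in>{..N}. (real k * (sqrt (L / 12000) / \<epsilon>))\<^sup>2)"
    unfolding sum_distrib_left
    using L by (intro sum.cong refl) (simp add: power_mult_distrib power_divide)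
  also have "\<dots> \<le> (\<Sum>k\<in>{..N}. \<bar>f k\<bar>)"
  proof (rule sum_mono)
    fix k assume "k \<in> {..N}"
    then have *: "0 \<le> f k" "real k * (sqrt (L / 12000) / \<epsilon>) \<le> sqrt (f k)"
      using quadratic_growth[OF \<epsilon> L f0 step] by auto
    have "(real k * (sqrt (L / 12000) / \<epsilon>))\<^sup>2 \<le> (sqrt (f k))\<^sup>2"
      using * \<epsilon> L by (intro power_mono) auto
    then show "(real k * (sqrt (L / 12000) / \<epsilon>))\<^sup>2 \<le> \<bar>f k\<bar>" using * by simp
  qed
  finally show ?thesis .
qed

section \<open>The lower bound on the number of voters\<close>

lemma voters_lower_bound:
  fixes L :: real
  assumes n: "120 \<le> n" and \<epsilon>: "0 < \<epsilon>" "\<epsilon> \<le> 1 / (11 * (real n - 1))"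
    and L: "15 \<le> L" and scheme: "plurality_scheme n m R B"
    and fail: "\<And>j. j \<in> {1..n} \<Longrightarrow> failure_prob n \<epsilon> m R B j \<le> exp (- L) / 25"
  shows "L / (72000 * \<epsilon>\<^sup>2) * (real n / 2 - 1) ^ 3 \<le> real m"
proof -
  let ?b = "vote_slope m R B"
  \<comment> \<open>From this middle urn, both the distance \<open>n - h\<close> to the last urn and
    the distance \<open>h - 1\<close> to the first are at least \<open>n / 2 - 1\<close>.\<close>
  define h where "h = Suc (n div 2)"
  have "1 / (11 * (real n - 1)) \<le> 1 / 50" using n by (intro divide_left_mono) auto
  then have \<epsilon>50: "\<epsilon> \<le> 1 / 50" using \<epsilon>(2) by linarith
  have L0: "0 < L" using L by simp
  have "2 \<le> n" using n by simp
  note increment = vote_slope_increment[OF this \<epsilon> _ _ L fail]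
  \<comment> \<open>The slopes increase, so they keep a constant sign on one half of the urns.\<close>
  have "\<exists>N. real n / 2 - 1 \<le> real N
      \<and> L / (36000 * \<epsilon>\<^sup>2) * real N ^ 3 \<le> (\<Sum>j\<in>{1..n}. \<bar>?b j\<bar>)"
  proof (cases "0 \<le> ?b h")
    case True
    define N where "N = n - h"
    have "L / (36000 * \<epsilon>\<^sup>2) * real N ^ 3 \<le> (\<Sum>k\<in>{..N}. \<bar>?b (h + k)\<bar>)"
      by (rule cubic_growth_of_sum[OF \<epsilon>(1) \<epsilon>50 L0])
         (use increment(1) True n in \<open>auto simp: N_def h_def\<close>)
    also have "\<dots> = (\<Sum>j\<in>(+) h ` {..N}. \<bar>?b j\<bar>)" by (simp add: sum.reindex)
    also have "\<dots> \<le> (\<Sum>j\<in>{1..n}. \<bar>?b j\<bar>)"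
      using n by (intro sum_mono2) (auto simp: N_def h_def)
    finally show ?thesis using n by (intro exI[of _ N]) (auto simp: N_def h_def)
  next
    case False
    define N where "N = h - 1"
    \<comment> \<open>The lower half is traversed downwards from \<open>h\<close> with the sign
      reversed, so the sequence again starts nonnegative and increases.\<close>
    have "L / (36000 * \<epsilon>\<^sup>2) * real N ^ 3 \<le> (\<Sum>k\<in>{..N}. \<bar>- ?b (h - k)\<bar>)"
    proof (rule cubic_growth_of_sum[OF \<epsilon>(1) \<epsilon>50 L0])
      fix k assume k: "k < N"
      then have "Suc (h - Suc k) = h - k" by (simp add: N_def)
      then show "sufficient_margin L (\<epsilon> * (- ?b (h - Suc k) - - ?b (h - k))) \<bar>- ?b (h - Suc k)\<bar>"
        using increment(2)[of "h - Suc k"] k n by (simp add: N_def h_def)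
    qed (use False in auto)
    also have "\<dots> = (\<Sum>j\<in>(-) h ` {..N}. \<bar>?b j\<bar>)"
      by (subst sum.reindex) (auto simp: N_def inj_on_def)
    also have "\<dots> \<le> (\<Sum>j\<in>{1..n}. \<bar>?b j\<bar>)"
      using n by (intro sum_mono2) (auto simp: N_def h_def)
    finally show ?thesis using n by (intro exI[of _ N]) (auto simp: N_def h_def)
  qed
  then obtain N where N: "real n / 2 - 1 \<le> real N"
    "L / (36000 * \<epsilon>\<^sup>2) * real N ^ 3 \<le> (\<Sum>j\<in>{1..n}. \<bar>?b j\<bar>)" by blast
  have "L / (36000 * \<epsilon>\<^sup>2) * (real n / 2 - 1) ^ 3 \<le> L / (36000 * \<epsilon>\<^sup>2) * real N ^ 3"
    using N(1) n L by (intro mult_left_mono power_mono) auto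
  also have "\<dots> \<le> 2 * real m" using N(2) sum_abs_vote_slope_le[OF scheme] by linarith
  finally show ?thesis by (simp add: field_simps)
qed

theorem theorem4:
  "\<exists>H c\<^sub>1 c\<^sub>2 :: real. 0 < H \<and> H < 1 \<and> 0 < c\<^sub>1 \<and> 0 < c\<^sub>2 \<and>
     (\<forall>(\<eta>::real) (n::nat) (\<epsilon>::real) (m::nat) R B.
        0 < \<eta> \<and> \<eta> < H \<and> n \<ge> 120 \<and> 0 < \<epsilon> \<and> \<epsilon> \<le> 1 / (11 * (real n - 1)) \<and>
        plurality_scheme n m R B \<and> real m \<le> c\<^sub>1 * (real n ^ 3 / \<epsilon>\<^sup>2) * ln (1 / \<eta>) \<longrightarrow>
        (\<exists>i\<in>{1..n}. failure_prob n \<epsilon> m R B i \<ge> c\<^sub>2 * \<eta>))"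
proof -
  \<comment> \<open>The choice \<open>H = exp (- 15)\<close> ensures \<open>L \<ge> 15\<close> for
    \<open>L = ln (1 / \<eta>)\<close>, and \<open>c\<^sub>2 = 1 / 25\<close> makes the failure
    threshold equal to \<open>exp (- L) / 25\<close>.\<close>
  have main: "\<exists>i\<in>{1..n}. failure_prob n \<epsilon> m R B i \<ge> 1 / 25 * \<eta>"
    if \<eta>: "0 < \<eta>" "\<eta> < exp (- 15)" and n: "120 \<le> n"
      and \<epsilon>: "0 < \<epsilon>" "\<epsilon> \<le> 1 / (11 * (real n - 1))" and scheme: "plurality_scheme n m R B"
      and m: "real m \<le> 1 / 10 ^ 7 * (real n ^ 3 / \<epsilon>\<^sup>2) * ln (1 / \<eta>)"
    for \<eta> \<epsilon> :: real and n m :: nat and R B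
  proof (rule ccontr)
    assume contr: "\<not> ?thesis"
    define L where "L = ln (1 / \<eta>)"
    have "ln \<eta> < - 15" using \<eta> by (metis exp_gt_zero ln_exp ln_less_cancel_iff)
    then have L: "15 \<le> L" using \<eta>(1) by (simp add: L_def ln_div)
    have "exp (- L) = \<eta>" using \<eta>(1) by (simp add: L_def ln_div)
    then have "L / (72000 * \<epsilon>\<^sup>2) * (real n / 2 - 1) ^ 3 \<le> real m"
      using contr by (intro voters_lower_bound[OF n \<epsilon> L scheme]) (auto simp: not_le intro: less_imp_le)
    \<comment> \<open>Replacing \<open>n / 2 - 1\<close> by \<open>n / 4\<close> gives the
      denominator 72000 * 64 = 4608000, below the \<open>10 ^ 7\<close> in \<open>c\<^sub>1\<close>,
      hence the contradiction.\<close>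
    moreover have "L / (72000 * \<epsilon>\<^sup>2) * (real n / 4) ^ 3 \<le> L / (72000 * \<epsilon>\<^sup>2) * (real n / 2 - 1) ^ 3"
      using n L by (intro mult_left_mono power_mono) auto
    ultimately have "L / (72000 * \<epsilon>\<^sup>2) * (real n / 4) ^ 3 \<le> 1 / 10 ^ 7 * (real n ^ 3 / \<epsilon>\<^sup>2) * L"
      using m by (simp add: L_def)
    then have "(L * real n ^ 3 / \<epsilon>\<^sup>2) * (1 / 4608000) \<le> (L * real n ^ 3 / \<epsilon>\<^sup>2) * (1 / 10 ^ 7)"
      by (simp add: power_divide mult_ac)
    moreover have "0 < L * real n ^ 3 / \<epsilon>\<^sup>2" using L n \<epsilon>(1) by simp
    ultimately show False by simp
  qed
  show ?thesis
    by (rule exI[of _ "exp (- 15)"], rule exI[of _ "1 / 10 ^ 7"], rule exI[of _ "1 / 25"])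
       (use main in \<open>auto simp del: power_numeral\<close>)
qed

end
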